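(* Let $\Phi=(D,\varphi)$ be a $\mathbb{T}$-gain unicyclic digraph on $n$ vertices whose unique directed cycle is $C_\ell$ (of length $\ell$), and let $g=\varphi(C_\ell)\in\mathbb{T}$. Then $$\operatorname{spec}(A(\Phi))=\{0^{\,n-\ell}\}\cup\{\lambda\in\mathbb{C}:\lambda^\ell=g\},$$ where $0^{\,n-\ell}$ denotes the eigenvalue $0$ with multiplicity $n-\ell$. Consequently, $\rho(\Phi)=1$.
   Context: A digraph $D=(V,\mathcal{A})$ has a finite vertex set $V=\{v_1,\dots,v_n\}$ and a set $\mathcal{A}$ of ordered pairs of distinct vertices, called arcs (no loops; at most one arc from $v_i$ to $v_j$ for each ordered pair). A directed cycle is a closed directed walk whose vertices are distinct except that the first and last coincide (so its length is at least $2$). A digraph is unicyclic if it is weakly connected and its underlying undirected graph (obtained by forgetting directions, each arc giving one edge, so a pair of opposite arcs is a cycle of length $2$) contains exactly one cycle. Throughout, only unicyclic digraphs whose unique cycle is a directed cycle are considered, and every remaining arc belongs to a directed tree whose arcs are oriented toward the cycle. Let $\mathbb{T}=\{z\in\mathbb{C}:|z|=1\}$. A $\mathbb{T}$-gain digraph is a pair $\Phi=(D,\varphi)$ with $\varphi:\mathcal{A}\to\mathbb{T}$ an arbitrary function; it is a $\mathbb{T}$-gain unicyclic digraph if $D$ is weakly connected, its underlying undirected graph (with one edge per arc) contains exactly one cycle, this cycle is a directed cycle of $D$, and every remaining arc of $D$ belongs to a directed tree whose arcs are oriented toward the cycle. Its gain adjacency matrix $A(\Phi)$ has entries $A(\Phi)_{ij}=\varphi(v_i,v_j)$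 if $(v_i,v_j)\in\mathcal{A}$ and $0$ otherwise. The gain $\varphi(C)$ of a directed cycle is the product of the gains of its arcs. $\operatorname{spec}(M)$ is the multiset of complex eigenvalues of $M$ (with algebraic multiplicity; the $\ell$ roots of $\lambda^\ell=g$ each occur once), and $\rho(\Phi)$ is the spectral radius (maximum modulus of an eigenvalue) of $A(\Phi)$. *)

theory Defs
  imports
    "Graph_Theory.Graph_Theory"
    "Jordan_Normal_Form.Spectral_Radius"
    "HOL-Computational_Algebra.Polynomial"
begin

text \<open>
  Digraphs are represented by \<^locale>\<open>pair_digraph\<close>: finite, without loops, arcs are ordered pairs
  of vertices. The constant \<^const>\<open>Digraph_Component.connected\<close> is weak connectedness.

  The underlying undirected graph keeps one edge per arc, so its edges are the arcs themselves, read
  as undirected edges between their two endpoints. In particular the opposite arcs \<open>(u, v)\<close> and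
  \<open>(v, u)\<close> are two parallel edges and form a cycle of length 2. (The library constants
  \<^const>\<open>mk_symmetric\<close> and \<^const>\<open>forest\<close> are not suitable here: the former merges such arcs,
  the latter only speaks about directed cycles.) A cycle of the underlying graph is identified with
  its set of edges \<open>S\<close>; below, the edge \<open>es ! i\<close> joins the cyclically consecutive vertices
  \<open>us ! i\<close> and \<open>us ! (i + 1)\<close>.
\<close>

definition underlying_cycle :: "'a pair_pre_digraph \<Rightarrow> ('a \<times> 'a) set \<Rightarrow> bool" where
  "underlying_cycle D S \<longleftrightarrow>
    (\<exists>us es. es \<noteq> [] \<and> length us = length es \<and> distinct us \<and> distinct es \<and>
       set es \<subseteq> parcs D \<and> S = set es \<and>
       (\<forall>i < length es.
          es ! i = (us ! i, us ! (Suc i mod length us)) \<or>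
          es ! i = (us ! (Suc i mod length us), us ! i)))"

definition directed_tree_toward :: "'a pair_pre_digraph \<Rightarrow> 'a \<Rightarrow> bool" where
  "directed_tree_toward T r \<longleftrightarrow>
     pair_digraph T \<and> Digraph_Component.connected (with_proj T) \<and> (\<nexists>S. underlying_cycle T S) \<and>
     r \<in> pverts T \<and> (\<forall>v \<in> pverts T. v \<rightarrow>\<^sup>*\<^bsub>with_proj T\<^esub> r)"

definition dicycle :: "'a pair_pre_digraph \<Rightarrow> ('a \<times> 'a) list \<Rightarrow> bool" where
  "dicycle D C \<longleftrightarrow> pre_digraph.cycle (with_proj D) C"

text \<open>
  A directed cycle is given by the list of its arcs, so \<open>fst ` set C\<close> is its set of vertices. A
  directed tree hanging off the cycle meets the cycle exactly in its root.
\<close>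

definition unicyclic_digraph :: "'a pair_pre_digraph \<Rightarrow> bool" where
  "unicyclic_digraph D \<longleftrightarrow>
     pair_digraph D \<and> Digraph_Component.connected (with_proj D) \<and>
     (\<exists>!S. underlying_cycle D S) \<and>
     (\<exists>C. dicycle D C \<and> underlying_cycle D (set C) \<and>
        (\<forall>a \<in> parcs D - set C. \<exists>T r.
           subgraph (with_proj T) (with_proj D) \<and> a \<in> parcs T \<and> directed_tree_toward T r \<and>
           pverts T \<inter> fst ` set C = {r}))"

definition T_gain_unicyclic_digraph ::
    "'a pair_pre_digraph \<Rightarrow> ('a \<times> 'a \<Rightarrow> complex) \<Rightarrow> bool" where
  "T_gain_unicyclic_digraph D \<phi> \<longleftrightarrow> unicyclic_digraph D \<and> (\<forall>a \<in> parcs D. cmod (\<phi> a) = 1)"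

text \<open>The list \<open>vs\<close> is the enumeration \<open>v\<^sub>1, \<dots>, v\<^sub>n\<close> of the vertices.\<close>

definition gain_adj_mat ::
    "'a pair_pre_digraph \<Rightarrow> ('a \<times> 'a \<Rightarrow> complex) \<Rightarrow> 'a list \<Rightarrow> complex mat" where
  "gain_adj_mat D \<phi> vs = mat (length vs) (length vs)
     (\<lambda>(i, j). if (vs ! i, vs ! j) \<in> parcs D then \<phi> (vs ! i, vs ! j) else 0)"

definition cycle_gain :: "('a \<times> 'a \<Rightarrow> complex) \<Rightarrow> ('a \<times> 'a) list \<Rightarrow> complex" where
  "cycle_gain \<phi> C = prod_list (map \<phi> C)"

definition spec :: "complex mat \<Rightarrow> complex multiset" where
  "spec M = proots (char_poly M)"

end

theory Submission
  imports Defs "HOL-Combinatorics.Cycles"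
begin

text \<open>
  In the Leibniz expansion of \<open>det (x I - A)\<close>, a permutation contributes only if every point it
  moves is moved along an arc. Each nontrivial orbit of such a permutation is then a cycle of the
  underlying graph, so by uniqueness it traces out \<open>C\<close>. Only the identity and the cyclic permutation
  along \<open>C\<close> survive, and the characteristic polynomial is \<open>x\<^sup>n - g x\<^bsup>n - \<ell>\<^esup>\<close>.
\<close>

section \<open>Cyclic permutations given by lists\<close>

lemma map_cycle_of_list:
  assumes "distinct cs"
  shows "map (cycle_of_list cs) cs = rotate1 cs"
  using cyclic_rotation[OF assms, of 1] by simp

text \<open>Each unfolding of \<open>cycle_of_list\<close> splits off one transposition, and a
  nonempty list of length k yields k - 1 of them.\<close>

lemma sign_cycle_of_list:
  assumes "distinct cs"
  shows "sign (cycle_of_list cs) = (- 1) ^ (length cs - 1)"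
  using assms
proof (induction cs rule: cycle_of_list.induct)
  case (1 i j cs)
  have "sign (cycle_of_list (i # j # cs)) = sign (transpose i j) * sign (cycle_of_list (j # cs))"
    unfolding cycle_of_list.simps by (rule sign_compose[OF permutation_swap_id permutation_of_cycle])
  with 1 show ?case
    by (simp add: sign_swap_id del: cycle_of_list.simps)
qed auto

section \<open>Characteristic polynomial and its roots\<close>

text \<open>The hypothesis \<open>perms\<close> isolates the combinatorics: it leaves only two
  Leibniz terms. The identity gives x^n because the diagonal of the matrix vanishes; the cycle gives
  its entry product times -x^(n-l), where l is the length of \<open>cs\<close>.\<close>

lemma char_poly_single_cycle:
  fixes A :: "'a :: comm_ring_1 mat"
  assumes A: "A \<in> carrier_mat n n"
    and cs: "distinct cs" "set cs \<subseteq> {..<n}" "cs \<noteq> []"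
    and moves: "\<And>i. i \<in> set cs \<Longrightarrow> cycle_of_list cs i \<noteq> i"
    and diag: "\<And>i. i < n \<Longrightarrow> A $$ (i, i) = 0"
    and perms: "\<And>p. \<lbrakk>p permutes {0..<n}; \<And>i. p i \<noteq> i \<Longrightarrow> A $$ (i, p i) \<noteq> 0; p \<noteq> id\<rbrakk>
      \<Longrightarrow> p = cycle_of_list cs"
  shows "char_poly A = monom 1 (n - length cs) *
    (monom 1 (length cs) - [:\<Prod>i\<leftarrow>cs. A $$ (i, cycle_of_list cs i):])"
proof -
  define c where "c = cycle_of_list cs"
  define M where "M = char_poly_matrix A"
  define t where "t p = signof p * (\<Prod>i = 0..<n. M $$ (i, p i))" for p
  have c_perm: "c permutes {0..<n}"
    unfolding c_def by (rule permutes_subset[OF cycle_permutes]) (use cs(2) in auto)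
  have M: "M $$ (i, j) = (if i = j then [:0, 1:] else [:- (A $$ (i, j)):])" if "i < n" "j < n" for i j
    using A that diag by (auto simp: M_def char_poly_matrix_def)
  have p_less: "p i < n" if "p permutes {0..<n}" "i < n" for p i
    using permutes_in_image[OF that(1), of i] that(2) by simp
  have "c \<noteq> id"
    using moves[of "hd cs"] cs(3) by (auto simp: c_def)
  \<comment> \<open>Such a \<open>p\<close> moves some \<open>i\<close> to a position where
    \<open>A\<close> vanishes; this factor is off the diagonal, so it kills the whole
    product.\<close>
  have zero: "t p = 0" if "p permutes {0..<n}" "p \<noteq> id" "p \<noteq> c" for p
  proof -
    obtain i where i: "p i \<noteq> i" "A $$ (i, p i) = 0"
      using perms[of p] \<open>p permutes _\<close> \<open>p \<noteq> id\<close> \<open>p \<noteq> c\<close> unfolding c_def by blast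
    then have "i < n"
      using permutes_not_in[OF that(1), of i] by force
    with i p_less[OF that(1)] have "M $$ (i, p i) = 0"
      by (auto simp: M)
    with \<open>i < n\<close> have "(\<Prod>i = 0..<n. M $$ (i, p i)) = 0"
      by (intro prod_zero) auto
    then show ?thesis
      by (simp add: t_def)
  qed
  have "char_poly A = (\<Sum>p | p permutes {0..<n}. t p)"
    unfolding char_poly_def t_def M_def by (rule det_def') (use A in simp)
  also have "\<dots> = (\<Sum>p\<in>{id, c}. t p)"
    by (rule sum.mono_neutral_right) (use c_perm permutes_id zero in \<open>auto simp: finite_permutations\<close>)
  also have "\<dots> = t id + t c"
    using \<open>c \<noteq> id\<close> by auto
  also have "t id = monom 1 n"
    by (simp add: t_def M monom_altdef)
  also have "t c = - (monom 1 (n - length cs) * [:\<Prod>i\<leftarrow>cs. A $$ (i, c i):])"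
  proof -
    have un: "{0..<n} = set cs \<union> ({0..<n} - set cs)"
      using cs(2) by auto
    have "(\<Prod>i = 0..<n. M $$ (i, c i)) =
        (\<Prod>i\<in>set cs. M $$ (i, c i)) * (\<Prod>i\<in>{0..<n} - set cs. M $$ (i, c i))"
      by (subst un, rule prod.union_disjoint) auto
    \<comment> \<open>Off the list \<open>c\<close> is the identity, so every factor is a diagonal
      entry x.\<close>
    also have "(\<Prod>i\<in>{0..<n} - set cs. M $$ (i, c i)) = (\<Prod>i\<in>{0..<n} - set cs. [:0, 1:])"
      by (rule prod.cong) (auto simp: c_def id_outside_supp M)
    also have "\<dots> = monom 1 (n - length cs)"
      using cs by (simp add: card_Diff_subset distinct_card subset_eq monom_altdef)
    also have "(\<Prod>i\<in>set cs. M $$ (i, c i)) = (\<Prod>i\<in>set cs. [:-1:] * [:A $$ (i, c i):])"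
    proof (rule prod.cong)
      fix i assume i: "i \<in> set cs"
      then have "i < n" using cs(2) by auto
      with i show "M $$ (i, c i) = [:-1:] * [:A $$ (i, c i):]"
        using p_less[OF c_perm] moves[OF i, symmetric] by (simp add: M c_def)
    qed auto
    also have "\<dots> = [:-1:] ^ length cs * (\<Prod>i\<in>set cs. [:A $$ (i, c i):])"
      by (simp only: prod.distrib prod_constant distinct_card[OF cs(1)])
    also have "(\<Prod>i\<in>set cs. [:A $$ (i, c i):]) = [:\<Prod>i\<in>set cs. A $$ (i, c i):]"
      by (induction rule: finite_induct[OF finite_set[of cs]]) (auto simp: one_pCons)
    also have "(\<Prod>i\<in>set cs. A $$ (i, c i)) = (\<Prod>i\<leftarrow>cs. A $$ (i, c i))"
      using cs(1) by (rule prod.distinct_set_conv_list)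
    finally have prod_eq: "(\<Prod>i = 0..<n. M $$ (i, c i)) =
      [:-1:] ^ length cs * [:\<Prod>i\<leftarrow>cs. A $$ (i, c i):] * monom 1 (n - length cs)" .
    have minus: "[:-1:] = (-1 :: 'a poly)"
      by (simp add: one_pCons)
    \<comment> \<open>The sign contributes the exponent l - 1 and the negated entries contribute l;
      their sum is odd since l is positive.\<close>
    have "signof c * [:-1:] ^ length cs = (-1 :: 'a poly)"
      using cs(3) unfolding c_def sign_cycle_of_list[OF cs(1)] minus
      by (cases cs) (auto simp flip: power_add mult_2)
    then show ?thesis
      unfolding t_def prod_eq by (simp add: mult.assoc[symmetric] mult.commute)
  qed
  also have "monom 1 n = monom 1 (n - length cs) * (monom 1 (length cs) :: 'a poly)"
    using card_mono[OF _ cs(2)] by (simp add: mult_monom distinct_card[OF cs(1)])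
  finally show ?thesis
    by (simp add: right_diff_distrib c_def)
qed

text \<open>The derivative can vanish only at 0, which is not a root because g is nonzero. Hence all
  roots are simple and the multiset of roots is a set.\<close>

lemma proots_monom_minus_const:
  fixes g :: complex
  assumes "l > 0" "g \<noteq> 0"
  shows "proots (monom 1 l - [:g:]) = mset_set {z. z ^ l = g}"
proof (rule multiset_eqI)
  fix z
  let ?p = "monom 1 l - [:g:]"
  have root: "poly ?p z = 0 \<longleftrightarrow> z ^ l = g" for z
    by (simp add: poly_monom)
  have rsq: "rsquarefree ?p"
    unfolding rsquarefree_roots
  proof safe
    fix a assume "poly ?p a = 0" "poly (pderiv ?p) a = 0"
    then show False
      using assms by (auto simp: root pderiv_diff pderiv_monom poly_monom pderiv_pCons)
  qed
  then have "?p \<noteq> 0"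
    by (simp add: rsquarefree_def)
  then have "order z ?p = (if z ^ l = g then 1 else 0)"
    using rsquarefree_root_order[OF rsq, of z] root[of z] by (simp add: order_0I)
  moreover have "finite {z. z ^ l = g}"
    using assms by auto
  ultimately show "count (proots ?p) z = count (mset_set {z. z ^ l = g}) z"
    using \<open>?p \<noteq> 0\<close> by (auto simp: count_mset_set')
qed

section \<open>Cycles as vertex lists paired with their rotation\<close>

text \<open>Both the given directed cycle and the orbits of a permutation take this form, which lets
  uniqueness identify their arc sets.\<close>

lemma underlying_cycle_zip_rotate1:
  assumes "us \<noteq> []" "distinct us" "set (zip us (rotate1 us)) \<subseteq> parcs D"
  shows "underlying_cycle D (set (zip us (rotate1 us)))"
  unfolding underlying_cycle_def
  using assms by (intro exI[of _ us] exI[of _ "zip us (rotate1 us)"])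
    (auto simp: distinct_zipI1 nth_rotate1 simp flip: length_greater_0_conv)

lemma map_fst_pcas:
  "pcas u C v \<Longrightarrow> map fst C @ [v] = u # map snd C"
  by (induction C arbitrary: u) auto

text \<open>In a closed walk the head of each arc is the tail of the next, so the list of heads is
  the rotated list of tails.\<close>

lemma dicycle_conv_zip_rotate1:
  assumes "dicycle D C"
  shows "C = zip (map fst C) (rotate1 (map fst C))"
    and "distinct (map fst C)" and "C \<noteq> []" and "set C \<subseteq> parcs D"
proof -
  obtain u where u: "pre_digraph.awalk (with_proj D) u C u"
      "distinct (tl (pre_digraph.awalk_verts (with_proj D) u C))" "C \<noteq> []"
    using assms unfolding dicycle_def pre_digraph.cycle_def by blast
  from u(1) have pcas: "pcas u C u" and arcs: "set C \<subseteq> parcs D"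
    by (simp_all add: pre_digraph.awalk_def cas_with_proj_eq)
  \<comment> \<open>Dropping the first vertex of the walk leaves exactly the heads of its
    arcs.\<close>
  have verts: "distinct (map snd C)"
    using u pcas by (simp add: pre_digraph.awalk_verts_conv' cas_with_proj_eq)
  obtain a C' where C: "C = a # C'"
    using u(3) by (cases C) auto
  have snd: "map snd C = rotate1 (map fst C)"
    using map_fst_pcas[OF pcas] by (simp add: C)
  show "C = zip (map fst C) (rotate1 (map fst C))"
    unfolding snd[symmetric] by (simp add: zip_map_fst_snd)
  show "distinct (map fst C)"
    using verts unfolding snd by simp
  show "C \<noteq> []" "set C \<subseteq> parcs D"
    by fact+
qed

text \<open>On the orbit list \<open>support p i\<close> the permutation agrees with the cycle of
  that list.\<close>

lemma support_rotate1:
  assumes "permutation p"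
  shows "map p (support p i) = rotate1 (support p i)"
proof -
  have "map p (support p i) = map (cycle_of_list (support p i)) (support p i)"
    by (rule map_cong[OF refl]) (rule cycle_restrict[OF assms])
  also have "\<dots> = rotate1 (support p i)"
    by (rule map_cycle_of_list[OF cycle_of_permutation[OF assms]])
  finally show ?thesis .
qed

section \<open>From uniqueness of the cycle to the gain adjacency matrix\<close>

lemma char_poly_gain_adj_mat:
  fixes D :: "'a pair_pre_digraph"
  assumes D: "unicyclic_digraph D"
    and \<phi>: "\<forall>a\<in>parcs D. cmod (\<phi> a) = 1"
    and vs: "distinct vs" "set vs = pverts D"
    and C: "dicycle D C"
  shows "char_poly (gain_adj_mat D \<phi> vs) =
    monom 1 (length vs - length C) * (monom 1 (length C) - [:cycle_gain \<phi> C:])"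
proof -
  interpret pair_digraph D
    using D by (simp add: unicyclic_digraph_def)
  note C_props = dicycle_conv_zip_rotate1[OF C]
  define n where "n = length vs"
  define A where "A = gain_adj_mat D \<phi> vs"
  have A: "A \<in> carrier_mat n n"
    by (simp add: A_def n_def gain_adj_mat_def)
  have A_nth: "A $$ (i, j) = (if (vs ! i, vs ! j) \<in> parcs D then \<phi> (vs ! i, vs ! j) else 0)"
    if "i < n" "j < n" for i j
    using that by (simp add: A_def n_def gain_adj_mat_def)
  have inj: "inj_on ((!) vs) {..<n}"
    using vs(1) by (auto simp: inj_on_def n_def nth_eq_iff_index_eq)
  have img: "(!) vs ` {..<n} = pverts D"
    using vs(2) by (auto simp: n_def set_conv_nth)
  have "set (map fst C) \<subseteq> (!) vs ` {..<n}"
    using arc_fst_in_verts subsetD[OF C_props(4)] by (simp only: img set_map image_subset_iff) blast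
  \<comment> \<open>The matrix indices of the tails of \<open>C\<close>, in cyclic order, found by
    inverting the enumeration \<open>vs\<close>.\<close>
  define cs where "cs = map (the_inv_into {..<n} ((!) vs)) (map fst C)"
  have cs_vs: "map ((!) vs) cs = map fst C"
    unfolding cs_def using \<open>set (map fst C) \<subseteq> _\<close>
    by (auto simp: f_the_inv_into_f[OF inj] intro!: map_idI)
  have cs_sub: "set cs \<subseteq> {..<n}"
    unfolding cs_def using \<open>set (map fst C) \<subseteq> _\<close> the_inv_into_into[OF inj _ order_refl] by auto
  have cs_dist: "distinct cs"
    using C_props(2) unfolding cs_vs[symmetric] by (simp add: distinct_map)
  have cs_len: "length cs = length C"
    by (simp add: cs_def)
  define c where "c = cycle_of_list cs"
  have c_rot: "map c cs = rotate1 cs"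
    unfolding c_def by (rule map_cycle_of_list[OF cs_dist])
  have C_eq: "C = map (\<lambda>i. (vs ! i, vs ! c i)) cs"
  proof -
    have "C = zip (map ((!) vs) cs) (map ((!) vs) (map c cs))"
      using C_props(1) unfolding cs_vs[symmetric] c_rot by (simp add: rotate1_map)
    then show ?thesis
      by (simp add: zip_map_map zip_same_conv_map)
  qed
  have c_sub: "c i \<in> set cs" if "i \<in> set cs" for i
    using c_rot that by (metis image_eqI set_map set_rotate1)
  have c_arc: "(vs ! i, vs ! c i) \<in> parcs D" if "i \<in> set cs" for i
    using C_props(4) C_eq that by auto
  \<comment> \<open>\<open>C\<close> is an arbitrary directed cycle; this makes its arc set the
    unique underlying cycle.\<close>
  have C_cycle: "underlying_cycle D (set C)"
    using underlying_cycle_zip_rotate1[of "map fst C" D] C_props(2-4)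
    unfolding C_props(1)[symmetric] by simp
  have perm_eq: "p = c"
    if p: "p permutes {0..<n}" and nz: "\<And>i. p i \<noteq> i \<Longrightarrow> A $$ (i, p i) \<noteq> 0" and "p \<noteq> id" for p
  proof -
    have perm: "permutation p"
      using p permutation_permutes by blast
    have less: "i < n" "p i < n" if "p i \<noteq> i" for i
      using permutes_not_in[OF p, of i] permutes_in_image[OF p, of i] that by auto
    have arc: "(vs ! i, vs ! p i) \<in> parcs D" if "p i \<noteq> i" for i
      using nz[OF that] A_nth less[OF that] by (auto split: if_splits)
    \<comment> \<open>Arcs are compared, not just vertices, so that the direction in which
      \<open>p\<close> traverses the cycle is determined too.\<close>
    have orbit: "(\<lambda>j. (vs ! j, vs ! p j)) ` set (support p i) = set C" if "p i \<noteq> i" for i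
    proof -
      define ws where "ws = support p i"
      have ws: "distinct ws" "map p ws = rotate1 ws"
        unfolding ws_def using cycle_of_permutation[OF perm] support_rotate1[OF perm] .
      \<comment> \<open>If an iterate of \<open>i\<close> were fixed, injectivity of that power of
        \<open>p\<close> would make \<open>i\<close> itself fixed.\<close>
      have moved: "p j \<noteq> j" if "j \<in> set ws" for j
      proof
        assume "p j = j"
        obtain k where k: "j = (p ^^ k) i"
          using \<open>j \<in> set ws\<close> by (auto simp: ws_def)
        have "(p ^^ k) (p i) = (p ^^ k) i"
          using \<open>p j = j\<close> k by (simp add: funpow_swap1)
        moreover have "inj (p ^^ k)"
          using inj_fn[OF permutes_inj[OF p]] .
        ultimately show False
          using \<open>p i \<noteq> i\<close> by (auto dest: injD)
      qed
      have sub: "set ws \<subseteq> {..<n}"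
        using less moved by auto
      have zip: "zip (map ((!) vs) ws) (rotate1 (map ((!) vs) ws)) = map (\<lambda>j. (vs ! j, vs ! p j)) ws"
        unfolding rotate1_map ws(2)[symmetric] by (simp add: zip_map_map zip_same_conv_map)
      have "ws \<noteq> []"
        using least_power_of_permutation(2)[OF perm, of i] by (simp add: ws_def)
      then have "underlying_cycle D (set (zip (map ((!) vs) ws) (rotate1 (map ((!) vs) ws))))"
        using ws(1) inj_on_subset[OF inj sub] moved arc
        by (intro underlying_cycle_zip_rotate1) (auto simp: zip distinct_map)
      with C_cycle D show ?thesis
        unfolding zip unicyclic_digraph_def ws_def[symmetric] by auto
    qed
    \<comment> \<open>The arc of \<open>C\<close> leaving \<open>vs ! j\<close> is also an arc of
      the orbit; comparing tails and heads through the injective \<open>vs\<close> gives the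
      claim.\<close>
    have on_cs: "p j = c j" if "j \<in> set cs" for j
    proof -
      obtain i where i: "p i \<noteq> i"
        using \<open>p \<noteq> id\<close> by (auto simp: fun_eq_iff)
      have "(vs ! j, vs ! c j) \<in> set C"
        using that C_eq by auto
      then obtain k where k: "k \<in> set (support p i)" "vs ! j = vs ! k" "vs ! c j = vs ! p k"
        unfolding orbit[OF i, symmetric] by auto
      obtain m where m: "k = (p ^^ m) i"
        using k(1) by auto
      have "i < n" by (rule less[OF i])
      then have kn: "k < n"
        using permutes_in_image[OF permutes_funpow[OF p, of m], of i] by (simp add: m)
      then have "p k < n"
        using permutes_in_image[OF p, of k] by simp
      have "j = k" "c j = p k"
        using inj_onD[OF inj k(2)] inj_onD[OF inj k(3)] that c_sub[OF that] cs_sub kn \<open>p k < n\<close>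
        by auto
      then show ?thesis
        by simp
    qed
    \<comment> \<open>A moved point has an orbit that again traces out \<open>C\<close>, so it would
      lie on \<open>cs\<close>.\<close>
    have off_cs: "p j = c j" if "j \<notin> set cs" for j
    proof -
      have "p j = j"
      proof (rule ccontr)
        assume j: "p j \<noteq> j"
        have "j \<in> set (support p j)"
          unfolding support_set[OF perm] by (rule range_eqI[of _ _ 0]) simp
        then have "(vs ! j, vs ! p j) \<in> set C"
          using orbit[OF j] by auto
        then obtain k where "k \<in> set cs" "vs ! j = vs ! k"
          using C_eq by auto
        with that less[OF j] cs_sub inj_onD[OF inj, of j k] show False
          by auto
      qed
      with that show ?thesis
        by (simp add: c_def id_outside_supp)
    qed
    show ?thesis
      using on_cs off_cs by blast
  qed
  have "char_poly A = monom 1 (n - length cs) *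
      (monom 1 (length cs) - [:\<Prod>i\<leftarrow>cs. A $$ (i, cycle_of_list cs i):])"
  proof (rule char_poly_single_cycle[OF A cs_dist cs_sub])
    show "cs \<noteq> []"
      using C_props(3) cs_len by auto
    \<comment> \<open>A fixed index would turn an arc of \<open>C\<close> into a loop.\<close>
    show "cycle_of_list cs i \<noteq> i" if "i \<in> set cs" for i
      using pair_no_loops[OF c_arc[OF that]] by (auto simp: c_def)
    show "A $$ (i, i) = 0" if "i < n" for i
      using pair_no_loops[of "(vs ! i, vs ! i)"] that by (auto simp: A_nth)
    show "p = cycle_of_list cs"
      if "p permutes {0..<n}" "\<And>i. p i \<noteq> i \<Longrightarrow> A $$ (i, p i) \<noteq> 0" "p \<noteq> id" for p
      using perm_eq[OF that] by (simp add: c_def)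
  qed
  also have "(\<Prod>i\<leftarrow>cs. A $$ (i, cycle_of_list cs i)) = cycle_gain \<phi> C"
  proof -
    have "map (\<lambda>i. A $$ (i, c i)) cs = map (\<lambda>i. \<phi> (vs ! i, vs ! c i)) cs"
      using cs_sub c_sub c_arc by (intro map_cong) (auto simp: A_nth subset_eq)
    also have "\<dots> = map \<phi> C"
      by (subst C_eq) simp
    finally show ?thesis
      by (simp add: cycle_gain_def c_def)
  qed
  finally show ?thesis
    by (simp add: A_def n_def cs_len)
qed

section \<open>Spectrum and spectral radius\<close>

theorem theorem4p4:
  fixes D :: "'a pair_pre_digraph" and \<phi> :: "'a \<times> 'a \<Rightarrow> complex"
    and vs :: "'a list" and C :: "('a \<times> 'a) list"
    and n l :: nat and g :: complex
  assumes "T_gain_unicyclic_digraph D \<phi>"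
    and "distinct vs" and "set vs = pverts D" and "n = card (pverts D)"
    and "dicycle D C" and "l = length C" and "g = cycle_gain \<phi> C"
  shows "spec (gain_adj_mat D \<phi> vs) = replicate_mset (n - l) 0 + mset_set {z. z ^ l = g} \<and>
         spectral_radius (gain_adj_mat D \<phi> vs) = 1"
proof -
  let ?A = "gain_adj_mat D \<phi> vs"
  have D: "unicyclic_digraph D" and \<phi>: "\<forall>a\<in>parcs D. cmod (\<phi> a) = 1"
    using assms(1) by (auto simp: T_gain_unicyclic_digraph_def)
  have n: "n = length vs"
    using assms(2-4) distinct_card by fastforce
  have l: "l > 0"
    using dicycle_conv_zip_rotate1(3)[OF assms(5)] assms(6) by simp
  \<comment> \<open>Stated for all lists of arcs, because removing the first arc of a directed cycle
    does not leave a directed cycle for the induction.\<close>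
  have "cmod (cycle_gain \<phi> C') = 1" if "set C' \<subseteq> parcs D" for C'
    using that \<phi> by (induction C') (auto simp: cycle_gain_def norm_mult)
  then have g: "cmod g = 1"
    using dicycle_conv_zip_rotate1(4)[OF assms(5)] assms(7) by simp
  then have "g \<noteq> 0"
    by auto
  have cp: "char_poly ?A = monom 1 (n - l) * (monom 1 l - [:g:])"
    using char_poly_gain_adj_mat[OF D \<phi> assms(2,3,5)] n assms(6,7) by simp
  have "poly (monom 1 l - [:g:]) 0 \<noteq> 0"
    using l \<open>g \<noteq> 0\<close> by (auto simp: poly_monom zero_power)
  then have nz: "monom 1 l - [:g:] \<noteq> 0"
    by auto
  have "proots (monom (1 :: complex) k) = replicate_mset k 0" for k
    using proots_linear_factor[of "0 :: complex"]
    by (simp add: monom_altdef proots_power repeat_mset_replicate_mset)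
  then have "spec ?A = replicate_mset (n - l) 0 + mset_set {z. z ^ l = g}"
    using nz proots_monom_minus_const[OF l \<open>g \<noteq> 0\<close>] by (simp add: spec_def cp proots_mult)
  moreover have "spectral_radius ?A = 1"
  proof -
    have A: "?A \<in> carrier_mat n n"
      by (simp add: n gain_adj_mat_def)
    have spectrum: "spectrum ?A = {z. poly (monom 1 (n - l) * (monom 1 l - [:g:])) z = 0}"
      by (simp only: spectrum_root_char_poly[OF A] cp)
    have norm: "cmod z = 1" if "z ^ l = g" for z
    proof -
      have "cmod z ^ l = 1 ^ l"
        using that g by (simp flip: norm_power)
      then show ?thesis
        by (rule power_eq_imp_eq_base) (use l in auto)
    qed
    \<comment> \<open>As \<open>l\<close> is positive, some root exists and modulus 1 is attained;
      any eigenvalue that is not such a root is 0.\<close>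
    have "card {z. z ^ l = g} = l"
      using card_nth_roots[of g l] \<open>g \<noteq> 0\<close> l by simp
    then obtain z where "z ^ l = g"
      using l by fastforce
    then have "1 \<in> cmod ` spectrum ?A"
      by (intro image_eqI[of _ _ z]) (simp_all add: spectrum poly_monom norm)
    moreover have "x \<le> 1" if "x \<in> cmod ` spectrum ?A" for x
      using that norm by (auto simp: spectrum poly_monom)
    moreover have "finite (cmod ` spectrum ?A)"
      using card_finite_spectrum(1)[OF A] by simp
    ultimately show ?thesis
      unfolding spectral_radius_def by (intro Max_eqI)
  qed
  ultimately show ?thesis ..
qed

end
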